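(* Consider the on-line setting under assumptions (i), (ii), (iii) of the context, let $\epsilon>0$ and let $n_0\in[1,2\sigma/\epsilon]$ be arbitrary. Run SPIDER-SFO with OPTION II (described in the context) from $\mathbf{x}^0$ with parameters $$S_1=\frac{2\sigma^2}{\epsilon^2},\quad S_2=\frac{2\sigma}{\epsilon n_0},\quad q=\frac{\sigma n_0}{\epsilon},\quad \eta^k=\min\left(\frac{\epsilon}{Ln_0\|\mathbf{v}^k\|},\frac{1}{2Ln_0}\right),\quad K=\left\lfloor (4L\Delta n_0)\epsilon^{-2}\right\rfloor+1 .$$ Then, after $K$ iterations, the output $\tilde{\mathbf{x}}$ satisfies $$\mathbb{E}\left[\|\nabla f(\tilde{\mathbf{x}})\|\right]\le 5\epsilon .$$ The gradient cost is bounded by $16L\Delta\sigma\cdot\epsilon^{-3}+2\sigma^2\epsilon^{-2}+4\sigma n_0^{-1}\epsilon^{-1}$ for any choice of $n_0\in[1,2\sigma/\epsilon]$. Treating $\Delta$, $L$ and $\sigma$ as positive constants, the stochastic gradient complexity is $\mathcal{O}(\epsilon^{-3})$.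
   Context: Setting (on-line case): $f:\mathbb{R}^d\to\mathbb{R}$ is $f(\mathbf{x})=\mathbb{E}_i[f_i(\mathbf{x})]$, where $i$ is a random index (from a possibly infinite index set) and each $f_i$ is differentiable, possibly non-convex, with $\mathbb{E}_i[\nabla f_i(\mathbf{x})]=\nabla f(\mathbf{x})$. $\|\cdot\|$ is the Euclidean norm. For a multiset $\mathcal{S}$ of $S$ sampled indices, $\nabla f_{\mathcal{S}}:=\frac1S\sum_{i\in\mathcal{S}}\nabla f_i$. Assumptions: (i) $\Delta:=f(\mathbf{x}^0)-f^*<\infty$, where $f^*=\inf_{\mathbf{x}}f(\mathbf{x})$; (ii) $\mathbb{E}_i\|\nabla f_i(\mathbf{x})-\nabla f_i(\mathbf{y})\|^2\le L^2\|\mathbf{x}-\mathbf{y}\|^2$ for all $\mathbf{x},\mathbf{y}$; (iii) $\mathbb{E}_i\|\nabla f_i(\mathbf{x})-\nabla f(\mathbf{x})\|^2\le\sigma^2<\infty$ for all $\mathbf{x}$. SPIDER-SFO, OPTION II: for $k=0,1,\dots,K-1$: if $k$ is a multiple of $q$, draw $S_1$ fresh independent samples $\mathcal{S}_1$ (with replacement) and set $\mathbf{v}^k=\nabla f_{\mathcal{S}_1}(\mathbf{x}^k)$; otherwise draw $S_2$ fresh independent samples $\mathcal{S}_2$ and set $\mathbf{v}^k=\nabla f_{\mathcal{S}_2}(\mathbf{x}^k)-\nabla f_{\mathcal{S}_2}(\mathbf{x}^{k-1})+\mathbf{v}^{k-1}$. Then set $\mathbf{x}^{k+1}=\mathbf{x}^k-\eta^k\mathbf{v}^k$.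 Output $\tilde{\mathbf{x}}$ chosen uniformly at random from $\{\mathbf{x}^k\}_{k=0}^{K-1}$. The quantities $S_1,S_2,q$ are treated as positive integers. Gradient cost: the total number of stochastic gradient accesses, where an iteration counts $S_1$ if $k$ is a multiple of $q$ and $S_2$ otherwise. *)

theory Defs
  imports "HOL-Probability.Probability" "HOL-Library.Landau_Symbols"
begin

(* Meaningful only where g is differentiable; the gradient is then unique. *)
definition grad :: "('a::real_inner \<Rightarrow> real) \<Rightarrow> 'a \<Rightarrow> 'a" where
  "grad g x = (THE D. GDERIV g x :> D)"

definition minibatch_grad ::
    "('i \<Rightarrow> 'a::real_inner \<Rightarrow> real) \<Rightarrow> nat \<Rightarrow> (nat \<Rightarrow> 'i) \<Rightarrow> 'a \<Rightarrow> 'a" where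
  "minibatch_grad F n s x = (1 / real n) *\<^sub>R (\<Sum>j<n. grad (F (s j)) x)"

definition batch_size :: "nat \<Rightarrow> nat \<Rightarrow> nat \<Rightarrow> nat \<Rightarrow> nat" where
  "batch_size S1 S2 q k = (if q dvd k then S1 else S2)"

(* For v = 0 the first argument of the minimum is infinite in the mathematical formula,
   whereas division by zero yields 0 in HOL. *)
definition step_size :: "real \<Rightarrow> real \<Rightarrow> real \<Rightarrow> 'a::real_normed_vector \<Rightarrow> real" where
  "step_size \<epsilon> L n0 v =
     (if v = 0 then 1 / (2 * L * n0) else min (\<epsilon> / (L * n0 * norm v)) (1 / (2 * L * n0)))"

(* The pair (x^k, v^k) after the k-th gradient estimate; s (k, j) is the j-th index sampled
   in iteration k and \<eta> maps v^k to the step size. *)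
primrec spider ::
    "('i \<Rightarrow> 'a::real_inner \<Rightarrow> real) \<Rightarrow> nat \<Rightarrow> nat \<Rightarrow> nat \<Rightarrow> ('a \<Rightarrow> real) \<Rightarrow> 'a \<Rightarrow>
     (nat \<times> nat \<Rightarrow> 'i) \<Rightarrow> nat \<Rightarrow> 'a \<times> 'a" where
  "spider F S1 S2 q \<eta> x0 s 0 = (x0, minibatch_grad F S1 (\<lambda>j. s (0, j)) x0)"
| "spider F S1 S2 q \<eta> x0 s (Suc k) =
    (let (x, v) = spider F S1 S2 q \<eta> x0 s k;
         x' = x - \<eta> v *\<^sub>R v;
         v' = (if q dvd Suc k then minibatch_grad F S1 (\<lambda>j. s (Suc k, j)) x'
               else minibatch_grad F S2 (\<lambda>j. s (Suc k, j)) x'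
                    - minibatch_grad F S2 (\<lambda>j. s (Suc k, j)) x + v)
     in (x', v'))"

definition spider_iterate ::
    "('i \<Rightarrow> 'a::real_inner \<Rightarrow> real) \<Rightarrow> nat \<Rightarrow> nat \<Rightarrow> nat \<Rightarrow> ('a \<Rightarrow> real) \<Rightarrow> 'a \<Rightarrow>
     (nat \<times> nat \<Rightarrow> 'i) \<Rightarrow> nat \<Rightarrow> 'a" where
  "spider_iterate F S1 S2 q \<eta> x0 s k = fst (spider F S1 S2 q \<eta> x0 s k)"

definition gradient_cost :: "nat \<Rightarrow> nat \<Rightarrow> nat \<Rightarrow> nat \<Rightarrow> nat" where
  "gradient_cost S1 S2 q K = (\<Sum>k<K. batch_size S1 S2 q k)"

definition sample_slots :: "nat \<Rightarrow> nat \<Rightarrow> nat \<Rightarrow> nat \<Rightarrow> (nat \<times> nat) set" where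
  "sample_slots S1 S2 q K = (SIGMA k:{..<K}. {..<batch_size S1 S2 q k})"

(* On the probability space \<Omega>, the samples \<xi> p (p in I) are i.i.d. with law M, and \<kappa> is
   uniform on {0, ..., K-1} and independent of all the samples jointly. *)
definition spider_randomness ::
    "'w measure \<Rightarrow> 'i measure \<Rightarrow> (nat \<times> nat) set \<Rightarrow> nat \<Rightarrow>
     (nat \<times> nat \<Rightarrow> 'w \<Rightarrow> 'i) \<Rightarrow> ('w \<Rightarrow> nat) \<Rightarrow> bool" where
  "spider_randomness \<Omega> M I K \<xi> \<kappa> \<longleftrightarrow>
     prob_space \<Omega> \<and>
     prob_space.indep_vars \<Omega> (\<lambda>_. M) \<xi> I \<and>
     (\<forall>p\<in>I. distr \<Omega> M (\<xi> p) = M) \<and>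
     \<kappa> \<in> measurable \<Omega> (count_space {..<K}) \<and>
     distr \<Omega> (count_space {..<K}) \<kappa> = uniform_count_measure {..<K} \<and>
     prob_space.indep_set \<Omega>
       (sets (vimage_algebra (space \<Omega>) (\<lambda>\<omega>. \<lambda>p\<in>I. \<xi> p \<omega>) (PiM I (\<lambda>_. M))))
       (sets (vimage_algebra (space \<Omega>) \<kappa> (count_space {..<K})))"

definition spider_params ::
    "real \<Rightarrow> real \<Rightarrow> real \<Rightarrow> real \<Rightarrow> real \<Rightarrow> nat \<Rightarrow> nat \<Rightarrow> nat \<Rightarrow> nat \<Rightarrow> bool" where
  "spider_params L \<sigma> \<Delta> \<epsilon> n0 S1 S2 q K \<longleftrightarrow>
     \<epsilon> > 0 \<and> 1 \<le> n0 \<and> n0 \<le> 2 * \<sigma> / \<epsilon> \<and>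
     real S1 = 2 * \<sigma>\<^sup>2 / \<epsilon>\<^sup>2 \<and>
     real S2 = 2 * \<sigma> / (\<epsilon> * n0) \<and>
     real q = \<sigma> * n0 / \<epsilon> \<and>
     K = nat \<lfloor>4 * L * \<Delta> * n0 / \<epsilon>\<^sup>2\<rfloor> + 1"

end

theory Submission
  imports Defs
begin

text \<open>
Write \<open>x\<^sup>k\<close>, \<open>v\<^sup>k\<close> for the iterates and gradient estimates, \<open>D\<^sup>k = v\<^sup>k - \<nabla>f(x\<^sup>k)\<close> for
the estimation error and \<open>\<eta>\<^sup>k\<close> for the step size. The proof splits into a deterministic part, valid for every
sequence of samples, and one second-moment estimate.

For the deterministic part, by Jensen's inequality the mean-square smoothness of the stochastic gradients
makes \<open>\<nabla>f\<close> Lipschitz with constant \<open>L\<close>, so each step decreases \<open>f\<close> by at least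
\<open>\<eta>\<^sup>k\<parallel>v\<^sup>k\<parallel>\<^sup>2/4 - \<eta>\<^sup>k\<parallel>D\<^sup>k\<parallel>\<^sup>2/2\<close>. Since the step has length at most \<open>\<epsilon>/(L n0)\<close>, the first term grows only
linearly in \<open>\<parallel>v\<^sup>k\<parallel>\<close>; but that is what is wanted, because the aim is a bound on norms and not on squared
norms. Telescoping gives \<open>sum_norm_grad_spider_iterate_le\<close>:
\<open>\<epsilon> \<Sum>\<parallel>\<nabla>f(x\<^sup>k)\<parallel> \<le> 4 L n0 \<Delta> + K \<epsilon>\<^sup>2 + (3/2) \<Sum>\<parallel>D\<^sup>k\<parallel>\<^sup>2\<close>, and \<open>K\<close> is chosen such that \<open>4 L n0 \<Delta> \<le> K \<epsilon>\<^sup>2\<close>.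

From probability theory it remains to see that \<open>E \<parallel>D\<^sup>k\<parallel>\<^sup>2 \<le> \<epsilon>\<^sup>2\<close>, which yields the average gradient norm
\<open>(1 + 1 + 3/2) \<epsilon> \<le> 5 \<epsilon>\<close>. Given the past, every fresh sample adds to the error a term of mean zero, so
second moments just add up. A refresh contributes \<open>\<sigma>\<^sup>2/S1 = \<epsilon>\<^sup>2/2\<close>. Each of the fewer than \<open>q\<close> corrections
after it contributes at most \<open>L\<^sup>2\<parallel>x\<^sup>k\<^sup>+\<^sup>1 - x\<^sup>k\<parallel>\<^sup>2/S2 \<le> (\<epsilon>/n0)\<^sup>2/S2 = \<epsilon>\<^sup>2/(2q)\<close>. This is
\<open>nn_integral_err_le\<close>; it rests on \<open>nn_integral_add_centered_sample\<close>, which integrates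
out one coordinate of a product space.

Two points of measure theory connect these parts with the statement. The map \<open>(i, x) \<mapsto> \<nabla>f\<^sub>i(x)\<close> must be
jointly measurable for the iterates to be random variables; it is, being a limit of difference quotients of
a function that is measurable in \<open>i\<close> and continuous in \<open>x\<close> (\<open>grad_borel_measurable\<close>).
And since the output index is uniform and independent of the samples, the expectation at the output is the average
over \<open>k < K\<close> of expectations over the product space of all samples (\<open>spider_randomness_uniform_index\<close>).

For the cost, \<open>S1 = q S2\<close>: spread over a period of \<open>q\<close> iterations, a refresh costs as much as the
corrections, so about \<open>2 S2\<close> gradients are spent per iteration.
\<close>


section \<open>Gradients and smooth functions\<close>

lemma GDERIV_unique:
  assumes "GDERIV g x :> D" and "GDERIV g x :> E"
  shows "D = E"
proof -
  have "(\<lambda>h. inner h D) = (\<lambda>h. inner h E)"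
    using assms unfolding gderiv_def by (rule has_derivative_unique)
  then have "inner h D = inner h E" for h
    by metis
  then show ?thesis
    by (metis vector_eq_ldot)
qed

text \<open>
The Riesz representation of the derivative, in coordinates, provides the gradient; so the description
operator in the definition of \<open>grad\<close> denotes something wherever the function is differentiable.
\<close>

lemma GDERIV_grad:
  fixes g :: "'a::euclidean_space \<Rightarrow> real"
  assumes "g differentiable (at x)"
  shows "GDERIV g x :> grad g x"
proof -
  obtain D where D: "(g has_derivative D) (at x)"
    using assms by (auto simp: differentiable_def)
  then have "linear D"
    by (rule has_derivative_linear)
  define d where "d = (\<Sum>b\<in>Basis. D b *\<^sub>R b)"
  have "D h = inner h d" for h
  proof -
    have "D h = D (\<Sum>b\<in>Basis. (h \<bullet> b) *\<^sub>R b)"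
      by (simp add: euclidean_representation)
    also have "\<dots> = (\<Sum>b\<in>Basis. (h \<bullet> b) * D b)"
      using \<open>linear D\<close> by (simp add: linear_sum linear_scale)
    also have "\<dots> = inner h d"
      by (simp add: d_def inner_sum_right mult.commute)
    finally show ?thesis .
  qed
  then have "GDERIV g x :> d"
    using D unfolding gderiv_def by (metis (no_types, lifting) ext)
  then show ?thesis
    unfolding grad_def by (rule theI) (rule GDERIV_unique[OF _ \<open>GDERIV g x :> d\<close>])
qed

lemma DERIV_along_line:
  fixes g :: "'a::euclidean_space \<Rightarrow> real"
  assumes "g differentiable (at (x + t *\<^sub>R b))"
  shows "((\<lambda>t. g (x + t *\<^sub>R b)) has_real_derivative grad g (x + t *\<^sub>R b) \<bullet> b) (at t)"
proof -
  have "((\<lambda>t. x + t *\<^sub>R b) has_derivative (\<lambda>h. h *\<^sub>R b)) (at t)"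
    by (auto intro!: derivative_eq_intros)
  from diff_chain_at[OF this GDERIV_grad[OF assms, unfolded gderiv_def]]
  show ?thesis
    by (simp add: has_field_derivative_def o_def inner_commute mult.commute[of "inner _ _"] mult_commute_abs)
qed

lemma difference_quotient_LIMSEQ:
  fixes g :: "'a::euclidean_space \<Rightarrow> real"
  assumes "g differentiable (at x)"
  shows "(\<lambda>n. (g (x + (1 / real (Suc n)) *\<^sub>R b) - g x) * real (Suc n)) \<longlonglongrightarrow> grad g x \<bullet> b"
proof -
  have "((\<lambda>h. (g (x + h *\<^sub>R b) - g x) / h) \<longlongrightarrow> grad g x \<bullet> b) (at 0)"
    using DERIV_along_line[of g x 0 b] assms by (simp add: DERIV_def)
  moreover have "filterlim (\<lambda>n. 1 / real (Suc n)) (at 0) sequentially"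
    unfolding filterlim_at using LIMSEQ_Suc[OF lim_1_over_n] by auto
  ultimately have "(\<lambda>n. (g (x + (1 / real (Suc n)) *\<^sub>R b) - g x) / (1 / real (Suc n))) \<longlonglongrightarrow> grad g x \<bullet> b"
    by (rule filterlim_compose)
  then show ?thesis
    by simp
qed

text \<open>
The descent lemma: along the segment the derivative of the difference of both sides is
\<open>(\<nabla>g(x + tv) - \<nabla>g(x)) \<bullet> v - t L \<parallel>v\<parallel>\<^sup>2\<close>, which the Lipschitz bound makes nonpositive.
\<close>

lemma smooth_upper_bound:
  fixes g :: "'a::euclidean_space \<Rightarrow> real"
  assumes diff: "\<And>x. g differentiable (at x)"
    and lip: "\<And>x y. norm (grad g x - grad g y) \<le> L * norm (x - y)"
  shows "g (x + v) \<le> g x + grad g x \<bullet> v + L / 2 * (norm v)\<^sup>2"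
proof -
  let ?h = "\<lambda>t. g (x + t *\<^sub>R v) - t * (grad g x \<bullet> v) - t\<^sup>2 * (L / 2 * (norm v)\<^sup>2)"
  have "?h 1 \<le> ?h 0"
  proof (rule DERIV_nonpos_imp_nonincreasing[of 0 1 ?h])
    fix t :: real
    assume t: "0 \<le> t" "t \<le> 1"
    let ?d = "grad g (x + t *\<^sub>R v) \<bullet> v - grad g x \<bullet> v - 2 * t * (L / 2 * (norm v)\<^sup>2)"
    have "(?h has_real_derivative ?d) (at t)"
      by (rule derivative_eq_intros DERIV_along_line diff refl | simp)+
    moreover have "(grad g (x + t *\<^sub>R v) - grad g x) \<bullet> v \<le> norm (grad g (x + t *\<^sub>R v) - grad g x) * norm v"
      by (rule norm_cauchy_schwarz)
    then have "(grad g (x + t *\<^sub>R v) - grad g x) \<bullet> v \<le> L * norm (t *\<^sub>R v) * norm v"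
      using mult_right_mono[OF lip[of "x + t *\<^sub>R v" x] norm_ge_zero[of v]] by simp
    then have "?d \<le> 0"
      using t by (simp add: power2_eq_square algebra_simps)
    ultimately show "\<exists>y. (?h has_real_derivative y) (at t) \<and> y \<le> 0"
      by blast
  qed simp
  then show ?thesis
    by simp
qed

section \<open>Joint measurability of the stochastic gradient\<close>

text \<open>
Approximating the identity by simple functions \<open>r\<^sub>n\<close> makes the second argument range over finitely
many values, for which measurability in the first argument suffices; continuity carries this over to
the limit.
\<close>

lemma Caratheodory_borel_measurable:
  fixes \<phi> :: "'i \<Rightarrow> 'a::{metric_space, second_countable_topology} \<Rightarrow> 'b::metric_space"
  assumes meas: "\<And>x. (\<lambda>i. \<phi> i x) \<in> borel_measurable M"
    and cont: "\<And>i x. i \<in> space M \<Longrightarrow> isCont (\<phi> i) x"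
  shows "(\<lambda>(i, x). \<phi> i x) \<in> borel_measurable (M \<Otimes>\<^sub>M borel)"
proof -
  obtain r :: "nat \<Rightarrow> 'a \<Rightarrow> 'a" where simple: "\<And>n. simple_function borel (r n)"
    and lim: "\<And>x. (\<lambda>n. r n x) \<longlonglongrightarrow> x"
    using borel_measurable_implies_sequence_metric[of "\<lambda>x. x" borel undefined] by auto
  show ?thesis
  proof (rule borel_measurable_LIMSEQ_metric)
    fix n
    have "r n \<in> measurable borel (count_space (range (r n)))"
      using simple[of n]
      by (subst measurable_count_space_eq_countable) (auto simp: simple_function_def countable_finite)
    then have "(\<lambda>p. r n (snd p)) \<in> measurable (M \<Otimes>\<^sub>M borel) (count_space (range (r n)))"
      by measurable
    then show "(\<lambda>(i, x). \<phi> i (r n x)) \<in> borel_measurable (M \<Otimes>\<^sub>M borel)"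
      unfolding case_prod_beta
    proof (rule measurable_compose_countable'[where f = "\<lambda>y p. \<phi> (fst p) y", rotated])
      show "countable (range (r n))"
        using simple[of n] by (auto simp: simple_function_def countable_finite)
      show "(\<lambda>p. \<phi> (fst p) y) \<in> borel_measurable (M \<Otimes>\<^sub>M borel)" for y
        using meas[of y] by measurable
    qed
  next
    fix p
    assume "p \<in> space (M \<Otimes>\<^sub>M (borel :: 'a measure))"
    then show "(\<lambda>n. case p of (i, x) \<Rightarrow> \<phi> i (r n x)) \<longlonglongrightarrow> (case p of (i, x) \<Rightarrow> \<phi> i x)"
      using lim cont by (auto simp: space_pair_measure intro: isCont_tendsto_compose)
  qed
qed

text \<open>
The gradients need not be continuous, so the preceding lemma is applied to the functions themselves, and
each component of the gradient is the limit of their difference quotients.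
\<close>

lemma grad_borel_measurable:
  fixes F :: "'i \<Rightarrow> 'a::euclidean_space \<Rightarrow> real"
  assumes meas: "\<And>x. (\<lambda>i. F i x) \<in> borel_measurable M"
    and diff: "\<And>i x. i \<in> space M \<Longrightarrow> F i differentiable (at x)"
  shows "(\<lambda>(i, x). grad (F i) x) \<in> borel_measurable (M \<Otimes>\<^sub>M borel)"
  unfolding case_prod_beta
proof (subst borel_measurable_euclidean_space, rule ballI)
  fix b :: 'a
  have F: "(\<lambda>(i, x). F i x) \<in> borel_measurable (M \<Otimes>\<^sub>M borel)"
    by (rule Caratheodory_borel_measurable[OF meas differentiable_imp_continuous_within[OF diff]])
  show "(\<lambda>p. grad (F (fst p)) (snd p) \<bullet> b) \<in> borel_measurable (M \<Otimes>\<^sub>M borel)"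
  proof (rule borel_measurable_LIMSEQ_real)
    fix n
    show "(\<lambda>p. (F (fst p) (snd p + (1 / real (Suc n)) *\<^sub>R b) - F (fst p) (snd p)) * real (Suc n))
      \<in> borel_measurable (M \<Otimes>\<^sub>M borel)"
      using F by measurable
  next
    fix p
    assume "p \<in> space (M \<Otimes>\<^sub>M (borel :: 'a measure))"
    then have "fst p \<in> space M"
      by (auto simp: space_pair_measure)
    then show "(\<lambda>n. (F (fst p) (snd p + (1 / real (Suc n)) *\<^sub>R b) - F (fst p) (snd p)) * real (Suc n))
      \<longlonglongrightarrow> grad (F (fst p)) (snd p) \<bullet> b"
      by (rule difference_quotient_LIMSEQ[OF diff])
  qed
qed

section \<open>Second moments under fresh samples\<close>

lemma (in prob_space)
  fixes Z :: "'a \<Rightarrow> 'b::euclidean_space"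
  assumes Z: "integrable M Z" "integrable M (\<lambda>i. (norm (Z i))\<^sup>2)"
  shows integrable_norm_sq_add: "integrable M (\<lambda>i. (norm (a + Z i))\<^sup>2)" (is ?thesis1)
    and expectation_norm_sq_add:
      "expectation (\<lambda>i. (norm (a + Z i))\<^sup>2)
        = (norm a)\<^sup>2 + 2 * (a \<bullet> expectation Z) + expectation (\<lambda>i. (norm (Z i))\<^sup>2)" (is ?thesis2)
proof -
  have eq: "(norm (a + Z i))\<^sup>2 = (norm a)\<^sup>2 + 2 * (a \<bullet> Z i) + (norm (Z i))\<^sup>2" for i
    by (simp add: power2_norm_eq_inner inner_add_left inner_add_right inner_commute)
  show ?thesis1
    unfolding eq using Z by simp
  show ?thesis2
    unfolding eq using Z by (simp add: prob_space)
qed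

lemma (in prob_space)
  fixes Z :: "'a \<Rightarrow> 'b::euclidean_space"
  assumes Z: "integrable M Z" "integrable M (\<lambda>i. (norm (Z i))\<^sup>2)"
  shows integrable_norm_sq_centered: "integrable M (\<lambda>i. (norm (Z i - expectation Z))\<^sup>2)"
    and expectation_norm_sq_centered:
      "expectation (\<lambda>i. (norm (Z i - expectation Z))\<^sup>2)
        = expectation (\<lambda>i. (norm (Z i))\<^sup>2) - (norm (expectation Z))\<^sup>2"
  using integrable_norm_sq_add[OF Z, of "- expectation Z"]
    expectation_norm_sq_add[OF Z, of "- expectation Z"]
  by (simp_all add: power2_norm_eq_inner)

text \<open>
Adding a term that depends on the fresh sample \<open>s p\<close>, and has mean zero once everything else is fixed,
raises the second moment by at most that term's second moment: by Tonelli's theorem the sample may be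
integrated out first, and then the cross term vanishes. Independence of \<open>A\<close> and \<open>h\<close> from the sample is
expressed as invariance under changing the coordinate \<open>p\<close>; this avoids conditional expectations and
filtrations.
\<close>

lemma (in prob_space) nn_integral_add_centered_sample:
  fixes A :: "('p \<Rightarrow> 'a) \<Rightarrow> 'b::euclidean_space"
  assumes "finite I" and p: "p \<in> I"
    and [measurable]: "A \<in> borel_measurable (PiM I (\<lambda>_. M))"
      "(\<lambda>s. h s (s p)) \<in> borel_measurable (PiM I (\<lambda>_. M))"
    and A: "\<And>s y. A (s(p := y)) = A s"
    and h: "\<And>s y. h (s(p := y)) = h s"
    and Z: "\<And>s. integrable M (h s)" "\<And>s. expectation (h s) = 0"
      "\<And>s. integrable M (\<lambda>y. (norm (h s y))\<^sup>2)" "\<And>s. expectation (\<lambda>y. (norm (h s y))\<^sup>2) \<le> c"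
    and "0 \<le> c"
  shows "(\<integral>\<^sup>+s. ennreal ((norm (A s + h s (s p)))\<^sup>2) \<partial>PiM I (\<lambda>_. M))
    \<le> (\<integral>\<^sup>+s. ennreal ((norm (A s))\<^sup>2) \<partial>PiM I (\<lambda>_. M)) + ennreal c"
proof -
  interpret P: product_sigma_finite "\<lambda>_::'p. M"
    by unfold_locales
  define J where "J = I - {p}"
  have J: "finite J" "p \<notin> J" "insert p J = I"
    using \<open>finite I\<close> p by (auto simp: J_def)
  interpret PI: prob_space "PiM I (\<lambda>_. M)"
    by (intro prob_space_PiM prob_space_axioms)
  have split: "(\<integral>\<^sup>+s. w s \<partial>PiM I (\<lambda>_. M)) = (\<integral>\<^sup>+s. \<integral>\<^sup>+y. w (s(p := y)) \<partial>M \<partial>PiM J (\<lambda>_. M))"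
    if "w \<in> borel_measurable (PiM I (\<lambda>_. M))" for w
    using P.product_nn_integral_insert[OF J(1,2), of w] that unfolding J(3) .
  have "(\<integral>\<^sup>+s. ennreal ((norm (A s + h s (s p)))\<^sup>2) \<partial>PiM I (\<lambda>_. M))
    = (\<integral>\<^sup>+s. \<integral>\<^sup>+y. ennreal ((norm (A s + h s y))\<^sup>2) \<partial>M \<partial>PiM J (\<lambda>_. M))"
    by (subst split) (simp_all add: A h)
  also have "\<dots> \<le> (\<integral>\<^sup>+s. ennreal ((norm (A s))\<^sup>2 + c) \<partial>PiM J (\<lambda>_. M))"
  proof (rule nn_integral_mono)
    fix s
    show "(\<integral>\<^sup>+y. ennreal ((norm (A s + h s y))\<^sup>2) \<partial>M) \<le> ennreal ((norm (A s))\<^sup>2 + c)"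
      using expectation_norm_sq_add[OF Z(1)[of s] Z(3)[of s], of "A s"] Z(2)[of s] Z(4)[of s]
      by (subst nn_integral_eq_integral)
        (auto intro!: integrable_norm_sq_add Z ennreal_leI simp del: ennreal_plus)
  qed
  also have "\<dots> = (\<integral>\<^sup>+s. ennreal ((norm (A s))\<^sup>2 + c) \<partial>PiM I (\<lambda>_. M))"
    by (subst split) (simp_all add: A emeasure_space_1)
  also have "\<dots> = (\<integral>\<^sup>+s. ennreal ((norm (A s))\<^sup>2) \<partial>PiM I (\<lambda>_. M)) + ennreal c"
    using \<open>0 \<le> c\<close> by (simp add: nn_integral_add PI.emeasure_space_1)
  finally show ?thesis .
qed

text \<open>
The scaling by \<open>1/n\<close> divides each sample's contribution by \<open>n\<^sup>2\<close>, so that \<open>n\<close> samples together contribute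
\<open>c/n\<close>. Here \<open>k\<close> is the iteration to which the samples \<open>(k, j)\<close> belong.
\<close>

lemma (in prob_space) nn_integral_add_centered_batch:
  fixes A :: "(nat \<times> nat \<Rightarrow> 'a) \<Rightarrow> 'b::euclidean_space"
  assumes "finite I" and I: "\<And>j. j < n \<Longrightarrow> (k, j) \<in> I"
    and A_meas [measurable]: "A \<in> borel_measurable (PiM I (\<lambda>_. M))"
    and h_meas: "\<And>j. j < n \<Longrightarrow> (\<lambda>s. h s (s (k, j))) \<in> borel_measurable (PiM I (\<lambda>_. M))"
    and A: "\<And>s j y. A (s((k, j) := y)) = A s"
    and h: "\<And>s j y. h (s((k, j) := y)) = h s"
    and Z: "\<And>s. integrable M (h s)" "\<And>s. expectation (h s) = 0"
      "\<And>s. integrable M (\<lambda>y. (norm (h s y))\<^sup>2)" "\<And>s. expectation (\<lambda>y. (norm (h s y))\<^sup>2) \<le> c"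
    and "0 \<le> c"
    and a: "(\<integral>\<^sup>+s. ennreal ((norm (A s))\<^sup>2) \<partial>PiM I (\<lambda>_. M)) \<le> ennreal a" "0 \<le> a"
  shows "(\<integral>\<^sup>+s. ennreal ((norm (A s + (1 / real n) *\<^sub>R (\<Sum>j<n. h s (s (k, j)))))\<^sup>2) \<partial>PiM I (\<lambda>_. M))
    \<le> ennreal (a + c / real n)"
proof -
  \<comment> \<open>The samples are added one at a time: relative to the partial sum of the first m samples, sample m is
    fresh.\<close>
  let ?D = "\<lambda>m s. A s + (1 / real n) *\<^sub>R (\<Sum>j<m. h s (s (k, j)))"
  have "?D m \<in> borel_measurable (PiM I (\<lambda>_. M)) \<and>
    (\<integral>\<^sup>+s. ennreal ((norm (?D m s))\<^sup>2) \<partial>PiM I (\<lambda>_. M)) \<le> ennreal (a + real m * (c / (real n)\<^sup>2))"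
    if "m \<le> n" for m
    using that
  proof (induction m)
    case 0
    then show ?case
      using a by simp
  next
    case (Suc m)
    then have [measurable]: "(\<lambda>s. h s (s (k, m))) \<in> borel_measurable (PiM I (\<lambda>_. M))"
      "?D m \<in> borel_measurable (PiM I (\<lambda>_. M))"
      and IH: "(\<integral>\<^sup>+s. ennreal ((norm (?D m s))\<^sup>2) \<partial>PiM I (\<lambda>_. M)) \<le> ennreal (a + real m * (c / (real n)\<^sup>2))"
      using h_meas by auto
    have step: "?D (Suc m) s = ?D m s + (1 / real n) *\<^sub>R h s (s (k, m))" for s
      by (simp add: algebra_simps)
    have "(\<integral>\<^sup>+s. ennreal ((norm (?D m s + (1 / real n) *\<^sub>R h s (s (k, m))))\<^sup>2) \<partial>PiM I (\<lambda>_. M))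
      \<le> (\<integral>\<^sup>+s. ennreal ((norm (?D m s))\<^sup>2) \<partial>PiM I (\<lambda>_. M)) + ennreal (c / (real n)\<^sup>2)"
    proof (rule nn_integral_add_centered_sample[where h = "\<lambda>s y. (1 / real n) *\<^sub>R h s y"])
      show "finite I" "(k, m) \<in> I"
        using Suc.prems I \<open>finite I\<close> by auto
      show "?D m (s((k, m) := y)) = ?D m s" for s y
        by (simp add: A h)
      show "expectation (\<lambda>y. (norm ((1 / real n) *\<^sub>R h s y))\<^sup>2) \<le> c / (real n)\<^sup>2" for s
        using Z(4)[of s] by (simp add: power_divide divide_right_mono)
    qed (use Z \<open>0 \<le> c\<close> in \<open>simp_all add: h power_divide\<close>)
    also have "\<dots> \<le> ennreal (a + real m * (c / (real n)\<^sup>2)) + ennreal (c / (real n)\<^sup>2)"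
      using IH by (rule add_right_mono)
    also have "\<dots> = ennreal (a + real (Suc m) * (c / (real n)\<^sup>2))"
      using a(2) \<open>0 \<le> c\<close>
      by (subst ennreal_plus[symmetric]) (auto simp: algebra_simps add_divide_distrib simp del: ennreal_plus)
    finally have "(\<integral>\<^sup>+s. ennreal ((norm (?D (Suc m) s))\<^sup>2) \<partial>PiM I (\<lambda>_. M))
      \<le> ennreal (a + real (Suc m) * (c / (real n)\<^sup>2))"
      unfolding step .
    moreover have "?D (Suc m) \<in> borel_measurable (PiM I (\<lambda>_. M))"
      unfolding step by measurable
    ultimately show ?case
      by blast
  qed
  from this[of n] show ?thesis
    by (cases "n = 0") (auto simp: power2_eq_square)
qed

section \<open>Deterministic analysis of the iteration\<close>

text \<open>
Only samples of the iterations up to \<open>k\<close> enter \<open>x\<^sup>k\<close> and \<open>v\<^sup>k\<close>. This gives both the freshness of later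
samples and the fact that finitely many samples determine a run.
\<close>

lemma spider_cong:
  assumes "\<And>k' j. k' \<le> k \<Longrightarrow> j < batch_size S1 S2 q k' \<Longrightarrow> s (k', j) = s' (k', j)"
  shows "spider F S1 S2 q \<eta> x0 s k = spider F S1 S2 q \<eta> x0 s' k"
  using assms
proof (induction k)
  case 0
  then show ?case
    by (simp add: minibatch_grad_def batch_size_def)
next
  case (Suc k)
  then have "spider F S1 S2 q \<eta> x0 s k = spider F S1 S2 q \<eta> x0 s' k"
    by simp
  moreover have "minibatch_grad F (batch_size S1 S2 q (Suc k)) (\<lambda>j. s (Suc k, j)) x
    = minibatch_grad F (batch_size S1 S2 q (Suc k)) (\<lambda>j. s' (Suc k, j)) x" for x
    using Suc.prems[of "Suc k"] by (simp add: minibatch_grad_def)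
  ultimately show ?case
    by (cases "q dvd Suc k") (simp_all add: batch_size_def Let_def)
qed

lemma spider_iterate_Suc:
  "spider_iterate F S1 S2 q \<eta> x0 s (Suc k)
    = spider_iterate F S1 S2 q \<eta> x0 s k
      - \<eta> (snd (spider F S1 S2 q \<eta> x0 s k)) *\<^sub>R snd (spider F S1 S2 q \<eta> x0 s k)"
  by (simp add: spider_iterate_def Let_def case_prod_beta)

lemma scaled_sum_diff_const:
  fixes w :: "nat \<Rightarrow> 'a::real_vector"
  assumes "0 < n"
  shows "(1 / real n) *\<^sub>R (\<Sum>j<n. w j - c) = (1 / real n) *\<^sub>R (\<Sum>j<n. w j) - c"
  using assms by (simp add: sum_subtractf scaleR_diff_right sum_constant_scaleR)

context
  fixes \<epsilon> L n0 :: real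
  assumes pos: "0 < \<epsilon>" "0 < L" "1 \<le> n0"
begin

lemma step_size_nonneg: "0 \<le> step_size \<epsilon> L n0 v"
  using pos by (simp add: step_size_def)

lemma step_size_le: "step_size \<epsilon> L n0 v \<le> 1 / (2 * L * n0)"
  by (simp add: step_size_def)

lemma norm_step_le: "norm (step_size \<epsilon> L n0 v *\<^sub>R v) \<le> \<epsilon> / (L * n0)"
proof (cases "v = 0")
  case False
  then have "step_size \<epsilon> L n0 v * norm v \<le> \<epsilon> / (L * n0 * norm v) * norm v"
    by (intro mult_right_mono) (auto simp: step_size_def)
  then show ?thesis
    using False step_size_nonneg[of v] by simp
qed (use pos in simp)

text \<open>
Up to the factor \<open>\<epsilon>\<^sup>2\<close> this is \<open>min(y, y\<^sup>2/2) \<ge> y - 1/2\<close> for \<open>y = \<parallel>v\<parallel>/\<epsilon>\<close>: the two branches of the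
minimum defining the step size are the normalized step and the plain gradient step.
\<close>

lemma step_size_norm_sq_ge:
  "\<epsilon> * norm v - \<epsilon>\<^sup>2 / 2 \<le> L * n0 * (step_size \<epsilon> L n0 v * (norm v)\<^sup>2)"
proof (cases "v = 0 \<or> step_size \<epsilon> L n0 v = 1 / (2 * L * n0)")
  case True
  then have "L * n0 * step_size \<epsilon> L n0 v = 1 / 2"
    using pos by (auto simp: step_size_def)
  then have "L * n0 * (step_size \<epsilon> L n0 v * (norm v)\<^sup>2) = 1 / 2 * (norm v)\<^sup>2"
    by (simp only: mult.assoc[symmetric])
  moreover have "0 \<le> (norm v - \<epsilon>)\<^sup>2"
    by simp
  then have "\<epsilon> * norm v - \<epsilon>\<^sup>2 / 2 \<le> (norm v)\<^sup>2 / 2"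
    by (simp add: power2_diff mult.commute)
  ultimately show ?thesis
    by linarith
next
  case False
  then have "step_size \<epsilon> L n0 v = \<epsilon> / (L * n0 * norm v)"
    by (auto simp: step_size_def min_def split: if_splits)
  then show ?thesis
    using False pos by (simp add: power2_eq_square)
qed

text \<open>
With \<open>h\<close> the step size and \<open>D = v - \<nabla>f(x)\<close>, the descent lemma, \<open>h L \<le> 1/2\<close> and
\<open>\<nabla>f(x) \<bullet> v \<ge> (\<parallel>v\<parallel>\<^sup>2 - \<parallel>D\<parallel>\<^sup>2)/2\<close> give a decrease of \<open>h\<parallel>v\<parallel>\<^sup>2/4 - h\<parallel>D\<parallel>\<^sup>2/2\<close>. Multiplying by \<open>4 L n0\<close> bounds \<open>\<epsilon>\<parallel>v\<parallel>\<close>, and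
\<open>\<epsilon>\<parallel>D\<parallel> \<le> (\<epsilon>\<^sup>2 + \<parallel>D\<parallel>\<^sup>2)/2\<close> replaces \<open>v\<close> by the gradient. The error thus enters through its square only,
so that the second moment of the error is all that is needed from probability theory.
\<close>

lemma spider_step_progress:
  fixes f :: "'a::euclidean_space \<Rightarrow> real"
  assumes diff: "\<And>x. f differentiable (at x)"
    and lip: "\<And>x y. norm (grad f x - grad f y) \<le> L * norm (x - y)"
  shows "\<epsilon> * norm (grad f x)
    \<le> 4 * L * n0 * (f x - f (x - step_size \<epsilon> L n0 v *\<^sub>R v)) + \<epsilon>\<^sup>2 + 3 / 2 * (norm (v - grad f x))\<^sup>2"
proof -
  define h where "h = step_size \<epsilon> L n0 v"
  define D where "D = v - grad f x"
  have h: "0 \<le> h" "h \<le> 1 / (2 * L * n0)"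
    unfolding h_def by (rule step_size_nonneg step_size_le)+
  then have hL: "h * (L * n0) \<le> 1 / 2"
    using pos by (simp add: field_simps)
  have "h * L \<le> h * (L * n0)"
    using h(1) pos by (simp add: mult_left_mono)
  then have "h * L \<le> 1 / 2"
    using hL by simp
  then have hh: "h * L * (h * (norm v)\<^sup>2) \<le> 1 / 2 * (h * (norm v)\<^sup>2)"
    using h(1) by (intro mult_right_mono) auto
  have "f (x + (- h *\<^sub>R v)) \<le> f x + grad f x \<bullet> (- h *\<^sub>R v) + L / 2 * (norm (- h *\<^sub>R v))\<^sup>2"
    by (rule smooth_upper_bound[OF diff lip])
  then have desc: "f (x - h *\<^sub>R v) \<le> f x - h * (grad f x \<bullet> v) + h * L * (h * (norm v)\<^sup>2) / 2"
    by (simp add: power_mult_distrib power2_eq_square mult_ac)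
  have "0 \<le> (norm (grad f x))\<^sup>2"
    by simp
  moreover have "(norm D)\<^sup>2 = (norm v)\<^sup>2 - 2 * (grad f x \<bullet> v) + (norm (grad f x))\<^sup>2"
    by (simp add: D_def power2_norm_eq_inner inner_diff_left inner_diff_right inner_commute)
  ultimately have "(norm v)\<^sup>2 / 2 - (norm D)\<^sup>2 / 2 \<le> grad f x \<bullet> v"
    by argo
  then have "h * ((norm v)\<^sup>2 / 2 - (norm D)\<^sup>2 / 2) \<le> h * (grad f x \<bullet> v)"
    using h(1) by (rule mult_left_mono)
  with desc hh have "h * (norm v)\<^sup>2 / 4 \<le> f x - f (x - h *\<^sub>R v) + h * (norm D)\<^sup>2 / 2"
    by (simp add: algebra_simps)
  then have "4 * (L * n0) * (h * (norm v)\<^sup>2 / 4)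
    \<le> 4 * (L * n0) * (f x - f (x - h *\<^sub>R v) + h * (norm D)\<^sup>2 / 2)"
    using pos by (intro mult_left_mono) auto
  moreover have "h * (L * n0) * (norm D)\<^sup>2 \<le> 1 / 2 * (norm D)\<^sup>2"
    using hL by (rule mult_right_mono) simp
  ultimately have "L * n0 * (h * (norm v)\<^sup>2) \<le> 4 * L * n0 * (f x - f (x - h *\<^sub>R v)) + (norm D)\<^sup>2"
    by (simp add: algebra_simps)
  then have v: "\<epsilon> * norm v \<le> 4 * L * n0 * (f x - f (x - h *\<^sub>R v)) + \<epsilon>\<^sup>2 / 2 + (norm D)\<^sup>2"
    using step_size_norm_sq_ge[of v] by (simp add: h_def)
  have "norm (grad f x) \<le> norm v + norm D"
    unfolding D_def by norm
  then have "\<epsilon> * norm (grad f x) \<le> \<epsilon> * norm v + \<epsilon> * norm D"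
    using pos by (simp add: distrib_left[symmetric])
  moreover have "0 \<le> (norm D - \<epsilon>)\<^sup>2"
    by simp
  then have "\<epsilon> * norm D \<le> \<epsilon>\<^sup>2 / 2 + (norm D)\<^sup>2 / 2"
    by (simp add: power2_diff mult.commute)
  ultimately show ?thesis
    using v by (simp add: h_def D_def)
qed

lemma sum_norm_grad_spider_iterate_le:
  fixes f :: "'a::euclidean_space \<Rightarrow> real"
  assumes diff: "\<And>x. f differentiable (at x)"
    and lip: "\<And>x y. norm (grad f x - grad f y) \<le> L * norm (x - y)"
    and bdd: "bdd_below (range f)"
    and spider: "\<And>k. spider F S1 S2 q (step_size \<epsilon> L n0) x0 s k = (x k, v k)"
  shows "\<epsilon> * (\<Sum>k<K. norm (grad f (x k)))
    \<le> 4 * L * n0 * (f x0 - (INF x. f x)) + real K * \<epsilon>\<^sup>2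
      + 3 / 2 * (\<Sum>k<K. (norm (v k - grad f (x k)))\<^sup>2)"
proof -
  have x_Suc: "x (Suc k) = x k - step_size \<epsilon> L n0 (v k) *\<^sub>R v k" for k
    using spider_iterate_Suc[of F S1 S2 q "step_size \<epsilon> L n0" x0 s k] by (simp add: spider_iterate_def spider del: spider.simps)
  have x_0: "x 0 = x0"
    using spider[of 0] by simp
  have "\<epsilon> * (\<Sum>k<K. norm (grad f (x k))) = (\<Sum>k<K. \<epsilon> * norm (grad f (x k)))"
    by (rule sum_distrib_left)
  also have "\<dots> \<le> (\<Sum>k<K. 4 * L * n0 * (f (x k) - f (x (Suc k))) + \<epsilon>\<^sup>2
      + 3 / 2 * (norm (v k - grad f (x k)))\<^sup>2)"
    by (intro sum_mono) (use spider_step_progress[OF diff lip] in \<open>simp add: x_Suc\<close>)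
  also have "\<dots> = 4 * L * n0 * (\<Sum>k<K. f (x k) - f (x (Suc k))) + real K * \<epsilon>\<^sup>2
      + 3 / 2 * (\<Sum>k<K. (norm (v k - grad f (x k)))\<^sup>2)"
    by (simp only: sum.distrib sum_distrib_left[symmetric] sum_constant card_lessThan)
  also have "(\<Sum>k<K. f (x k) - f (x (Suc k))) = f x0 - f (x K)"
    using sum_lessThan_telescope'[of "\<lambda>k. f (x k)" K] x_0 by simp
  also have "4 * L * n0 * (f x0 - f (x K)) \<le> 4 * L * n0 * (f x0 - (INF x. f x))"
    using pos cINF_lower[OF bdd, of "x K"] by (intro mult_left_mono) auto
  finally show ?thesis
    by simp
qed

end

section \<open>Stochastic gradients and their variance\<close>

locale stochastic_oracle = prob_space M
  for M :: "'i measure" +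
  fixes F :: "'i \<Rightarrow> 'a::euclidean_space \<Rightarrow> real" and f :: "'a \<Rightarrow> real" and L \<sigma> :: real
  assumes F_differentiable: "\<And>i x. i \<in> space M \<Longrightarrow> F i differentiable (at x)"
    and F_measurable: "\<And>x. (\<lambda>i. F i x) \<in> borel_measurable M"
    and grad_integrable: "\<And>x. integrable M (\<lambda>i. grad (F i) x)"
    and unbiased: "\<And>x. expectation (\<lambda>i. grad (F i) x) = grad f x"
    and L_nonneg: "0 \<le> L"
    and smooth_integrable: "\<And>x y. integrable M (\<lambda>i. (norm (grad (F i) x - grad (F i) y))\<^sup>2)"
    and smooth: "\<And>x y. expectation (\<lambda>i. (norm (grad (F i) x - grad (F i) y))\<^sup>2) \<le> L\<^sup>2 * (norm (x - y))\<^sup>2"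
    and variance_integrable: "\<And>x. integrable M (\<lambda>i. (norm (grad (F i) x - grad f x))\<^sup>2)"
    and variance: "\<And>x. expectation (\<lambda>i. (norm (grad (F i) x - grad f x))\<^sup>2) \<le> \<sigma>\<^sup>2"
begin

lemma grad_measurable: "(\<lambda>(i, x). grad (F i) x) \<in> borel_measurable (M \<Otimes>\<^sub>M borel)"
  by (rule grad_borel_measurable[OF F_measurable F_differentiable])

text \<open>
The centred increment of one stochastic gradient from \<open>y\<close> to \<open>x\<close>: up to the factor \<open>1/S2\<close>, what a single
sample adds to the estimation error in an iteration that is not a refresh.
\<close>

definition correction :: "'a \<Rightarrow> 'a \<Rightarrow> 'i \<Rightarrow> 'a" where
  "correction x y i = grad (F i) x - grad (F i) y - (grad f x - grad f y)"

lemma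
  shows correction_integrable: "integrable M (correction x y)"
    and expectation_correction: "expectation (correction x y) = 0"
    and correction_sq_integrable: "integrable M (\<lambda>i. (norm (correction x y i))\<^sup>2)"
    and correction_second_moment:
      "expectation (\<lambda>i. (norm (correction x y i))\<^sup>2)
        = expectation (\<lambda>i. (norm (grad (F i) x - grad (F i) y))\<^sup>2) - (norm (grad f x - grad f y))\<^sup>2"
  using integrable_norm_sq_centered[OF _ smooth_integrable[of x y]]
    expectation_norm_sq_centered[OF _ smooth_integrable[of x y]]
  unfolding correction_def
  by (simp_all add: grad_integrable unbiased prob_space)

text \<open>
Jensen's inequality for the squared norm, in the form that the variance of the gradient difference is
nonnegative.
\<close>

lemma grad_f_lipschitz: "norm (grad f x - grad f y) \<le> L * norm (x - y)"
proof -
  have "0 \<le> expectation (\<lambda>i. (norm (correction x y i))\<^sup>2)"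
    by simp
  then have "(norm (grad f x - grad f y))\<^sup>2 \<le> (L * norm (x - y))\<^sup>2"
    using smooth[of x y] by (simp add: correction_second_moment power_mult_distrib)
  then show ?thesis
    by (rule power2_le_imp_le) (simp add: L_nonneg)
qed

lemma correction_second_moment_le:
  "expectation (\<lambda>i. (norm (correction x y i))\<^sup>2) \<le> L\<^sup>2 * (norm (x - y))\<^sup>2"
  using smooth[of x y] zero_le_power2[of "norm (grad f x - grad f y)"]
  unfolding correction_second_moment by linarith

lemma grad_f_measurable [measurable]: "grad f \<in> borel_measurable borel"
proof (intro borel_measurable_continuous_onI lipschitz_on_continuous_on lipschitz_onI)
  show "dist (grad f x) (grad f y) \<le> L * dist x y" for x y
    using grad_f_lipschitz[of x y] by (simp add: dist_norm)
qed (rule L_nonneg)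

end

section \<open>The estimation error of SPIDER\<close>

text \<open>
Any measurable rule for the step size is admitted whose steps have length at most \<open>\<rho>\<close>, since the step
length is the only way in which the rule enters the bound on the error.
Random objects are functions on the product space of all samples of the first \<open>K\<close> iterations.
\<close>

locale spider_process = stochastic_oracle M F f L \<sigma>
  for M :: "'i measure" and F :: "'i \<Rightarrow> 'a::euclidean_space \<Rightarrow> real" and f L \<sigma> +
  fixes S1 S2 q K :: nat and \<eta> :: "'a \<Rightarrow> real" and x0 :: 'a and \<rho> :: real
  assumes S_pos: "0 < S1" "0 < S2"
    and step_measurable [measurable]: "\<eta> \<in> borel_measurable borel"
    and norm_step: "\<And>v. norm (\<eta> v *\<^sub>R v) \<le> \<rho>"
begin

abbreviation slots :: "(nat \<times> nat) set" where
  "slots \<equiv> sample_slots S1 S2 q K"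

abbreviation samples :: "(nat \<times> nat \<Rightarrow> 'i) measure" where
  "samples \<equiv> PiM slots (\<lambda>_. M)"

definition iterate :: "(nat \<times> nat \<Rightarrow> 'i) \<Rightarrow> nat \<Rightarrow> 'a" where
  "iterate s k = spider_iterate F S1 S2 q \<eta> x0 s k"

definition estimate :: "(nat \<times> nat \<Rightarrow> 'i) \<Rightarrow> nat \<Rightarrow> 'a" where
  "estimate s k = snd (spider F S1 S2 q \<eta> x0 s k)"

definition err :: "(nat \<times> nat \<Rightarrow> 'i) \<Rightarrow> nat \<Rightarrow> 'a" where
  "err s k = estimate s k - grad f (iterate s k)"

lemma spider_eq: "spider F S1 S2 q \<eta> x0 s k = (iterate s k, estimate s k)"
  by (simp add: iterate_def estimate_def spider_iterate_def)

lemma iterate_0: "iterate s 0 = x0"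
  by (simp add: iterate_def spider_iterate_def)

lemma iterate_Suc: "iterate s (Suc k) = iterate s k - \<eta> (estimate s k) *\<^sub>R estimate s k"
  unfolding iterate_def estimate_def by (rule spider_iterate_Suc)

lemma estimate_refresh:
  assumes "q dvd k"
  shows "estimate s k = minibatch_grad F S1 (\<lambda>j. s (k, j)) (iterate s k)"
  using assms by (cases k) (simp_all add: estimate_def iterate_def spider_iterate_def Let_def case_prod_beta)

lemma estimate_correct:
  assumes "\<not> q dvd Suc k"
  shows "estimate s (Suc k) = minibatch_grad F S2 (\<lambda>j. s (Suc k, j)) (iterate s (Suc k))
    - minibatch_grad F S2 (\<lambda>j. s (Suc k, j)) (iterate s k) + estimate s k"
  using assms by (simp add: estimate_def iterate_def spider_iterate_def Let_def case_prod_beta)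

lemma finite_slots: "finite slots"
  by (simp add: sample_slots_def)

lemma slots_iff: "(k, j) \<in> slots \<longleftrightarrow> k < K \<and> j < batch_size S1 S2 q k"
  by (simp add: sample_slots_def)

lemma iterate_estimate_cong:
  assumes "\<And>k' j. k' \<le> k \<Longrightarrow> j < batch_size S1 S2 q k' \<Longrightarrow> s (k', j) = s' (k', j)"
  shows "iterate s k = iterate s' k" and "estimate s k = estimate s' k"
  using spider_cong[of k S1 S2 q s s' F \<eta> x0] assms by (simp_all add: spider_eq)

lemma iterate_estimate_later_slot:
  assumes "k < m"
  shows "iterate (s((m, j) := y)) k = iterate s k" and "estimate (s((m, j) := y)) k = estimate s k"
  using assms by (intro iterate_estimate_cong; auto)+

text \<open>
The point of iteration \<open>k\<close> is fixed before the samples of iteration \<open>k\<close> are drawn.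
\<close>

lemma iterate_same_slot: "iterate (s((k, j) := y)) k = iterate s k"
proof (cases k)
  case (Suc m)
  then show ?thesis
    by (simp add: iterate_Suc iterate_estimate_later_slot)
qed (simp add: iterate_0)

lemma grad_slot_measurable:
  assumes "p \<in> slots" and X: "X \<in> borel_measurable samples"
  shows "(\<lambda>s. grad (F (s p)) (X s)) \<in> borel_measurable samples"
proof -
  have "(\<lambda>s. (s p, X s)) \<in> measurable samples (M \<Otimes>\<^sub>M borel)"
    using measurable_component_singleton[OF assms(1), of "\<lambda>_. M"] X by (rule measurable_Pair)
  from measurable_compose[OF this grad_measurable] show ?thesis
    by simp
qed

lemma minibatch_grad_measurable:
  assumes "k < K" and X: "X \<in> borel_measurable samples"
  shows "(\<lambda>s. minibatch_grad F (batch_size S1 S2 q k) (\<lambda>j. s (k, j)) (X s)) \<in> borel_measurable samples"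
  unfolding minibatch_grad_def using assms
  by (intro borel_measurable_scaleR borel_measurable_const borel_measurable_sum grad_slot_measurable)
    (simp_all add: slots_iff)

lemma iterate_estimate_measurable:
  assumes "k < K"
  shows "(\<lambda>s. iterate s k) \<in> borel_measurable samples \<and> (\<lambda>s. estimate s k) \<in> borel_measurable samples"
  using assms
proof (induction k)
  case 0
  then show ?case
    using minibatch_grad_measurable[of 0 "\<lambda>_. x0"] by (simp add: iterate_0 estimate_refresh batch_size_def)
next
  case (Suc k)
  then have [measurable]: "(\<lambda>s. iterate s k) \<in> borel_measurable samples"
    "(\<lambda>s. estimate s k) \<in> borel_measurable samples"
    by auto
  have x: "(\<lambda>s. iterate s (Suc k)) \<in> borel_measurable samples"
    unfolding iterate_Suc by measurable
  note mb = minibatch_grad_measurable[OF Suc.prems]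
  have "(\<lambda>s. estimate s (Suc k)) \<in> borel_measurable samples"
  proof (cases "q dvd Suc k")
    case True
    then show ?thesis
      using mb[OF x] by (simp add: estimate_refresh batch_size_def)
  next
    case False
    then show ?thesis
      using mb[OF x] mb[of "\<lambda>s. iterate s k"] by (simp add: estimate_correct batch_size_def)
  qed
  with x show ?case
    by simp
qed

lemma err_measurable: "k < K \<Longrightarrow> (\<lambda>s. err s k) \<in> borel_measurable samples"
  unfolding err_def using iterate_estimate_measurable[of k]
  by (auto intro!: borel_measurable_diff measurable_compose[OF _ grad_f_measurable])

lemma err_refresh:
  assumes "q dvd k"
  shows "err s k = (1 / real S1) *\<^sub>R (\<Sum>j<S1. grad (F (s (k, j))) (iterate s k) - grad f (iterate s k))"
  using assms S_pos by (simp add: err_def estimate_refresh minibatch_grad_def scaled_sum_diff_const)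

lemma err_correct:
  assumes "\<not> q dvd Suc k"
  shows "err s (Suc k) = err s k
    + (1 / real S2) *\<^sub>R (\<Sum>j<S2. correction (iterate s (Suc k)) (iterate s k) (s (Suc k, j)))"
  using assms S_pos unfolding correction_def
  by (simp add: err_def estimate_correct minibatch_grad_def scaled_sum_diff_const)
     (simp add: sum_subtractf scaleR_diff_right)

text \<open>
A refresh forgets the past error, hence the batch is added to the constant 0.
\<close>

lemma nn_integral_err_refresh:
  assumes "q dvd k" "k < K"
  shows "(\<integral>\<^sup>+s. ennreal ((norm (err s k))\<^sup>2) \<partial>samples) \<le> ennreal (\<sigma>\<^sup>2 / real S1)"
proof -
  have [measurable]: "(\<lambda>s. iterate s k) \<in> borel_measurable samples"
    using iterate_estimate_measurable assms by blast
  let ?h = "\<lambda>s i. grad (F i) (iterate s k) - grad f (iterate s k)"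
  have "(\<integral>\<^sup>+s. ennreal ((norm (0 + (1 / real S1) *\<^sub>R (\<Sum>j<S1. ?h s (s (k, j)))))\<^sup>2) \<partial>samples)
    \<le> ennreal (0 + \<sigma>\<^sup>2 / real S1)"
  proof (rule nn_integral_add_centered_batch[where h = ?h])
    fix j
    assume "j < S1"
    then show p: "(k, j) \<in> slots"
      using assms by (simp add: slots_iff batch_size_def)
    show "(\<lambda>s. grad (F (s (k, j))) (iterate s k) - grad f (iterate s k)) \<in> borel_measurable samples"
      using grad_slot_measurable[OF p, of "\<lambda>s. iterate s k"] by measurable
  qed (simp_all add: finite_slots iterate_same_slot grad_integrable unbiased prob_space
      variance variance_integrable)
  then show ?thesis
    using assms by (simp add: err_refresh)
qed

lemma nn_integral_err_correct:
  assumes "\<not> q dvd Suc k" "Suc k < K"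
    and a: "(\<integral>\<^sup>+s. ennreal ((norm (err s k))\<^sup>2) \<partial>samples) \<le> ennreal a" "0 \<le> a"
  shows "(\<integral>\<^sup>+s. ennreal ((norm (err s (Suc k)))\<^sup>2) \<partial>samples) \<le> ennreal (a + (L * \<rho>)\<^sup>2 / real S2)"
proof -
  have [measurable]: "(\<lambda>s. iterate s k) \<in> borel_measurable samples"
    "(\<lambda>s. iterate s (Suc k)) \<in> borel_measurable samples"
    using iterate_estimate_measurable[of k] iterate_estimate_measurable[of "Suc k"] assms(2) by auto
  let ?h = "\<lambda>s. correction (iterate s (Suc k)) (iterate s k)"
  have "(\<integral>\<^sup>+s. ennreal ((norm (err s k + (1 / real S2) *\<^sub>R (\<Sum>j<S2. ?h s (s (Suc k, j)))))\<^sup>2) \<partial>samples)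
    \<le> ennreal (a + (L * \<rho>)\<^sup>2 / real S2)"
  proof (rule nn_integral_add_centered_batch[where h = ?h])
    fix j
    assume "j < S2"
    then show p: "(Suc k, j) \<in> slots"
      using assms by (simp add: slots_iff batch_size_def)
    show "(\<lambda>s. ?h s (s (Suc k, j))) \<in> borel_measurable samples"
      unfolding correction_def
      using grad_slot_measurable[OF p, of "\<lambda>s. iterate s k"] grad_slot_measurable[OF p, of "\<lambda>s. iterate s (Suc k)"]
      by measurable
  next
    fix s
    have "norm (iterate s (Suc k) - iterate s k) \<le> \<rho>"
      using norm_step[of "estimate s k"] by (simp add: iterate_Suc)
    then have "L\<^sup>2 * (norm (iterate s (Suc k) - iterate s k))\<^sup>2 \<le> (L * \<rho>)\<^sup>2"
      by (simp add: power_mult_distrib mult_left_mono power_mono)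
    with correction_second_moment_le
    show "expectation (\<lambda>y. (norm (?h s y))\<^sup>2) \<le> (L * \<rho>)\<^sup>2"
      by (rule order_trans)
  qed (use a assms(2) in \<open>simp_all add: finite_slots iterate_same_slot iterate_estimate_later_slot err_def
      correction_integrable expectation_correction correction_sq_integrable
      err_measurable[unfolded err_def]\<close>)
  then show ?thesis
    using assms(1) by (simp add: err_correct)
qed

text \<open>
The number of corrections since the last refresh is \<open>k mod q\<close>.
\<close>

lemma nn_integral_err_le:
  assumes "k < K"
  shows "(\<integral>\<^sup>+s. ennreal ((norm (err s k))\<^sup>2) \<partial>samples)
    \<le> ennreal (\<sigma>\<^sup>2 / real S1 + real (k mod q) * ((L * \<rho>)\<^sup>2 / real S2))"
  using assms
proof (induction k)
  case 0
  then show ?case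
    using nn_integral_err_refresh[of 0] by simp
next
  case (Suc k)
  show ?case
  proof (cases "q dvd Suc k")
    case True
    then show ?thesis
      using nn_integral_err_refresh[of "Suc k"] Suc.prems by simp
  next
    case False
    then have "Suc k mod q = Suc (k mod q)"
      by (auto simp: mod_Suc dvd_eq_mod_eq_0)
    moreover have "(\<integral>\<^sup>+s. ennreal ((norm (err s (Suc k)))\<^sup>2) \<partial>samples)
      \<le> ennreal ((\<sigma>\<^sup>2 / real S1 + real (k mod q) * ((L * \<rho>)\<^sup>2 / real S2)) + (L * \<rho>)\<^sup>2 / real S2)"
      using Suc False by (intro nn_integral_err_correct) auto
    ultimately show ?thesis
      by (simp add: algebra_simps add_divide_distrib del: ennreal_plus)
  qed
qed

end

section \<open>From the random output to an average over iterations\<close>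

text \<open>
Samples and output index are jointly distributed as the product of their laws, so Tonelli's theorem
turns the expectation at the random index into a finite average. The joint law is computed on
rectangles, directly from the independence of the two generated \<open>\<sigma>\<close>-algebras.
\<close>

lemma spider_randomness_uniform_index:
  fixes W :: "nat \<Rightarrow> (nat \<times> nat \<Rightarrow> 'i) \<Rightarrow> real"
  assumes rand: "spider_randomness \<Omega> M I K \<xi> \<kappa>" and "prob_space M" and "I \<noteq> {}" "0 < K"
    and W: "\<And>k. k < K \<Longrightarrow> W k \<in> borel_measurable (PiM I (\<lambda>_. M))"
  shows "(\<lambda>\<omega>. W (\<kappa> \<omega>) (\<lambda>p\<in>I. \<xi> p \<omega>)) \<in> borel_measurable \<Omega>" (is ?meas)
    and "(\<integral>\<^sup>+\<omega>. ennreal (W (\<kappa> \<omega>) (\<lambda>p\<in>I. \<xi> p \<omega>)) \<partial>\<Omega>)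
      = (\<integral>\<^sup>+s. (\<Sum>k<K. ennreal (1 / real K) * ennreal (W k s)) \<partial>PiM I (\<lambda>_. M))" (is ?int)
proof -
  interpret prob_space \<Omega>
    using rand by (simp add: spider_randomness_def)
  let ?X = "\<lambda>\<omega>. \<lambda>p\<in>I. \<xi> p \<omega>"
  let ?C = "count_space {..<K}" and ?U = "uniform_count_measure {..<K}"
  let ?P = "PiM I (\<lambda>_. M)"
  have \<xi>: "indep_vars (\<lambda>_. M) \<xi> I" and law: "\<And>p. p \<in> I \<Longrightarrow> distr \<Omega> M (\<xi> p) = M"
    and \<kappa> [measurable]: "\<kappa> \<in> measurable \<Omega> ?C" and \<kappa>_law: "distr \<Omega> ?C \<kappa> = ?U"
    and ind: "indep_set (sets (vimage_algebra (space \<Omega>) ?X ?P)) (sets (vimage_algebra (space \<Omega>) \<kappa> ?C))"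
    using rand by (auto simp: spider_randomness_def)
  have rv: "\<And>p. p \<in> I \<Longrightarrow> \<xi> p \<in> measurable \<Omega> M"
    using \<xi> by (simp add: indep_vars_def2)
  then have X [measurable]: "?X \<in> measurable \<Omega> ?P"
    by (rule measurable_restrict)
  have X_law: "distr \<Omega> ?P ?X = ?P"
  proof -
    have "distr \<Omega> ?P ?X = PiM I (\<lambda>p. distr \<Omega> M (\<xi> p))"
      using indep_vars_iff_distr_eq_PiM'[where I = I and M' = "\<lambda>_. M" and X = \<xi>] \<open>I \<noteq> {}\<close> rv \<xi> by blast
    also have "\<dots> = ?P"
      by (rule PiM_cong) (simp_all add: law)
    finally show ?thesis .
  qed
  interpret U: prob_space ?U
    using \<open>0 < K\<close> by (intro prob_space_uniform_count_measure) auto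
  interpret P: prob_space ?P
    using \<open>prob_space M\<close> by (intro prob_space_PiM)
  have joint: "?P \<Otimes>\<^sub>M ?U = distr \<Omega> (?P \<Otimes>\<^sub>M ?C) (\<lambda>\<omega>. (?X \<omega>, \<kappa> \<omega>))"
  proof (rule pair_measure_eqI)
    fix A B
    assume A: "A \<in> sets ?P" and "B \<in> sets ?U"
    then have B: "B \<in> sets ?C"
      by (simp add: sets_uniform_count_measure)
    have "prob ((?X -` A \<inter> space \<Omega>) \<inter> (\<kappa> -` B \<inter> space \<Omega>))
      = prob (?X -` A \<inter> space \<Omega>) * prob (\<kappa> -` B \<inter> space \<Omega>)"
      using A B by (intro indep_setD[OF ind] in_vimage_algebra)
    moreover have "emeasure ?P A = emeasure \<Omega> (?X -` A \<inter> space \<Omega>)"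
      using emeasure_distr[OF X A] by (simp only: X_law)
    moreover have "emeasure ?U B = emeasure \<Omega> (\<kappa> -` B \<inter> space \<Omega>)"
      using emeasure_distr[OF \<kappa> B] by (simp only: \<kappa>_law)
    moreover have "emeasure (distr \<Omega> (?P \<Otimes>\<^sub>M ?C) (\<lambda>\<omega>. (?X \<omega>, \<kappa> \<omega>))) (A \<times> B)
      = emeasure \<Omega> ((?X -` A \<inter> space \<Omega>) \<inter> (\<kappa> -` B \<inter> space \<Omega>))"
      using A B by (subst emeasure_distr) (auto intro!: arg_cong[where f = "emeasure \<Omega>"])
    ultimately show "emeasure ?P A * emeasure ?U B
      = emeasure (distr \<Omega> (?P \<Otimes>\<^sub>M ?C) (\<lambda>\<omega>. (?X \<omega>, \<kappa> \<omega>))) (A \<times> B)"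
      by (simp add: emeasure_eq_measure ennreal_mult[symmetric])
  next
    show "sets (?P \<Otimes>\<^sub>M ?U) = sets (distr \<Omega> (?P \<Otimes>\<^sub>M ?C) (\<lambda>\<omega>. (?X \<omega>, \<kappa> \<omega>)))"
      unfolding sets_distr by (intro sets_pair_measure_cong refl sets_uniform_count_measure_count_space)
  qed (rule P.sigma_finite_measure_axioms U.sigma_finite_measure_axioms)+
  have W' [measurable]: "(\<lambda>p. W (snd p) (fst p)) \<in> borel_measurable (?P \<Otimes>\<^sub>M ?C)"
    by (rule measurable_compose_countable'[where f = "\<lambda>k p. W k (fst p)" and I = "{..<K}"])
       (auto intro: measurable_compose[OF measurable_fst W])
  show ?meas
    using measurable_compose[OF _ W', of "\<lambda>\<omega>. (?X \<omega>, \<kappa> \<omega>)" \<Omega>] by simp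
  have "(\<integral>\<^sup>+\<omega>. ennreal (W (\<kappa> \<omega>) (?X \<omega>)) \<partial>\<Omega>)
    = (\<integral>\<^sup>+p. ennreal (W (snd p) (fst p)) \<partial>distr \<Omega> (?P \<Otimes>\<^sub>M ?C) (\<lambda>\<omega>. (?X \<omega>, \<kappa> \<omega>)))"
    by (subst nn_integral_distr) auto
  also have "\<dots> = (\<integral>\<^sup>+p. ennreal (W (snd p) (fst p)) \<partial>(?P \<Otimes>\<^sub>M ?U))"
    by (simp only: joint)
  also have "\<dots> = (\<integral>\<^sup>+s. \<integral>\<^sup>+k. ennreal (W k s) \<partial>?U \<partial>?P)"
    by (subst U.nn_integral_fst[symmetric]) auto
  also have "\<dots> = (\<integral>\<^sup>+s. (\<Sum>k<K. ennreal (1 / real K) * ennreal (W k s)) \<partial>?P)"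
    unfolding uniform_count_measure_def
    by (subst nn_integral_point_measure_finite) (auto)
  finally show ?int .
qed

section \<open>Parameters and gradient cost\<close>

lemma spider_params_facts:
  assumes "spider_params L \<sigma> \<Delta> \<epsilon> n0 S1 S2 q K" and "0 < L" "0 \<le> \<Delta>"
  shows "0 < \<epsilon>" "1 \<le> n0" "0 < \<sigma>" "\<epsilon> \<le> 2 * \<sigma>" "0 < S1" "0 < S2" "0 < q" "0 < K"
    and "S1 = q * S2"
    and "real K * \<epsilon>\<^sup>2 \<ge> 4 * L * \<Delta> * n0" "real K \<le> 4 * L * \<Delta> * n0 / \<epsilon>\<^sup>2 + 1"
proof -
  from assms(1) have \<epsilon>: "0 < \<epsilon>" and n0: "1 \<le> n0" "n0 \<le> 2 * \<sigma> / \<epsilon>"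
    and S1: "real S1 = 2 * \<sigma>\<^sup>2 / \<epsilon>\<^sup>2" and S2: "real S2 = 2 * \<sigma> / (\<epsilon> * n0)" and q: "real q = \<sigma> * n0 / \<epsilon>"
    and K: "K = nat \<lfloor>4 * L * \<Delta> * n0 / \<epsilon>\<^sup>2\<rfloor> + 1"
    by (auto simp: spider_params_def)
  show "0 < \<epsilon>" "1 \<le> n0" "0 < K"
    using \<epsilon> n0 K by auto
  have "1 \<le> 2 * \<sigma> / \<epsilon>"
    using n0 by linarith
  then show \<epsilon>\<sigma>: "\<epsilon> \<le> 2 * \<sigma>"
    using \<epsilon> by (simp add: field_simps)
  then show \<sigma>: "0 < \<sigma>"
    using \<epsilon> by simp
  have "0 < real S1" "0 < real S2" "0 < real q"
    unfolding S1 S2 q using \<epsilon> \<sigma> n0 by auto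
  then show "0 < S1" "0 < S2" "0 < q"
    by auto
  have "real S1 = real (q * S2)"
    unfolding of_nat_mult S1 S2 q using \<epsilon> n0 by (simp add: field_simps power2_eq_square)
  then show "S1 = q * S2"
    by (simp only: of_nat_eq_iff)
  define t where "t = 4 * L * \<Delta> * n0 / \<epsilon>\<^sup>2"
  have t: "0 \<le> t"
    using assms n0 by (simp add: t_def)
  then have "real K = of_int \<lfloor>t\<rfloor> + 1"
    using K by (simp add: t_def[symmetric])
  then have "t \<le> real K" "real K \<le> t + 1"
    by linarith+
  then show "real K * \<epsilon>\<^sup>2 \<ge> 4 * L * \<Delta> * n0" "real K \<le> 4 * L * \<Delta> * n0 / \<epsilon>\<^sup>2 + 1"
    using \<epsilon> by (simp_all add: t_def field_simps)
qed

text \<open>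
There are at most \<open>K div q + 1\<close> multiples of \<open>q\<close> below \<open>K\<close>; the batches of size \<open>q * S2\<close> at all but one of
them are paid for by \<open>K * S2\<close>.
\<close>

lemma gradient_cost_le:
  "gradient_cost (q * S2) S2 q K \<le> 2 * K * S2 + q * S2"
proof -
  have "{k \<in> {..<K}. q dvd k} \<subseteq> (\<lambda>m. m * q) ` {..K div q}"
  proof
    fix k
    assume "k \<in> {k \<in> {..<K}. q dvd k}"
    then have "k = k div q * q" "k div q \<le> K div q"
      by (simp_all add: div_le_mono)
    then show "k \<in> (\<lambda>m. m * q) ` {..K div q}"
      by blast
  qed
  then have "card {k \<in> {..<K}. q dvd k} \<le> card {..K div q}"
    by (rule surj_card_le[rotated]) simp
  then have "card {k \<in> {..<K}. q dvd k} * (q * S2) \<le> Suc (K div q) * (q * S2)"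
    by (intro mult_le_mono1) simp
  also have "\<dots> = K div q * q * S2 + q * S2"
    by (simp add: algebra_simps)
  also have "\<dots> \<le> K * S2 + q * S2"
    by (intro add_le_mono1 mult_le_mono1) simp
  finally have big: "card {k \<in> {..<K}. q dvd k} * (q * S2) \<le> K * S2 + q * S2" .
  have "gradient_cost (q * S2) S2 q K \<le> (\<Sum>k<K. S2 + (if q dvd k then q * S2 else 0))"
    unfolding gradient_cost_def batch_size_def by (rule sum_mono) auto
  also have "\<dots> = K * S2 + card {k \<in> {..<K}. q dvd k} * (q * S2)"
    by (simp add: sum.distrib sum.If_cases Int_def)
  finally show ?thesis
    using big by simp
qed

lemma spider_gradient_cost_le:
  assumes params: "spider_params L \<sigma> \<Delta> \<epsilon> n0 S1 S2 q K" and "0 < L" "0 \<le> \<Delta>"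
  shows "real (gradient_cost S1 S2 q K)
    \<le> 16 * L * \<Delta> * \<sigma> / \<epsilon> ^ 3 + 2 * \<sigma>\<^sup>2 / \<epsilon>\<^sup>2 + 4 * \<sigma> / (n0 * \<epsilon>)"
proof -
  note p = spider_params_facts[OF assms]
  have S1: "real S1 = 2 * \<sigma>\<^sup>2 / \<epsilon>\<^sup>2" and S2: "real S2 = 2 * \<sigma> / (\<epsilon> * n0)"
    using params by (auto simp: spider_params_def)
  have "real (gradient_cost S1 S2 q K) \<le> real (2 * K * S2 + S1)"
    using gradient_cost_le[of q S2 K] unfolding p(9)[symmetric] by (rule of_nat_mono)
  also have "\<dots> = 2 * (2 * \<sigma> / (\<epsilon> * n0)) * real K + 2 * \<sigma>\<^sup>2 / \<epsilon>\<^sup>2"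
    by (simp add: S1 S2)
  also have "\<dots> \<le> 2 * (2 * \<sigma> / (\<epsilon> * n0)) * (4 * L * \<Delta> * n0 / \<epsilon>\<^sup>2 + 1) + 2 * \<sigma>\<^sup>2 / \<epsilon>\<^sup>2"
    using p(1-3,11) by (intro add_right_mono mult_left_mono) auto
  also have "\<dots> = 16 * L * \<Delta> * \<sigma> / \<epsilon> ^ 3 + 2 * \<sigma>\<^sup>2 / \<epsilon>\<^sup>2 + 4 * \<sigma> / (n0 * \<epsilon>)"
    using p(1,2) by (simp add: field_simps power2_eq_square power3_eq_cube)
  finally show ?thesis .
qed

text \<open>
The parameters can only exist if \<open>\<epsilon> \<le> 2 \<sigma>\<close>, because the interval for \<open>n0\<close> is empty otherwise; so the
lower-order terms of the cost are absorbed into \<open>1/\<epsilon>\<^sup>3\<close> with a constant not depending on \<open>n0\<close>.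
\<close>

lemma spider_gradient_cost_bigo:
  assumes params: "\<And>\<epsilon>. \<epsilon> \<in> E \<Longrightarrow> spider_params L \<sigma> \<Delta> \<epsilon> (n0 \<epsilon>) (S1 \<epsilon>) (S2 \<epsilon>) (q \<epsilon>) (K \<epsilon>)"
    and "0 < L" "0 \<le> \<Delta>"
  shows "(\<lambda>\<epsilon>. real (gradient_cost (S1 \<epsilon>) (S2 \<epsilon>) (q \<epsilon>) (K \<epsilon>))) \<in> O[at 0 within E](\<lambda>\<epsilon>. 1 / \<epsilon> ^ 3)"
proof (rule bigoI)
  let ?c = "16 * L * \<Delta> * \<sigma> + 2 * \<sigma>\<^sup>2 * (2 * \<sigma>) + 4 * \<sigma> * (2 * \<sigma>)\<^sup>2"
  have "norm (real (gradient_cost (S1 \<epsilon>) (S2 \<epsilon>) (q \<epsilon>) (K \<epsilon>))) \<le> ?c * norm (1 / \<epsilon> ^ 3)"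
    if "\<epsilon> \<in> E" for \<epsilon> :: real
  proof -
    note p = spider_params_facts[OF params[OF that] assms(2,3)]
    have "4 * \<sigma> / (n0 \<epsilon> * \<epsilon>) \<le> 4 * \<sigma> / (1 * \<epsilon>)"
      using p by (intro divide_left_mono mult_right_mono mult_pos_pos) auto
    then have "real (gradient_cost (S1 \<epsilon>) (S2 \<epsilon>) (q \<epsilon>) (K \<epsilon>))
      \<le> 16 * L * \<Delta> * \<sigma> / \<epsilon> ^ 3 + 2 * \<sigma>\<^sup>2 / \<epsilon>\<^sup>2 + 4 * \<sigma> / \<epsilon>"
      using spider_gradient_cost_le[OF params[OF that] assms(2,3)] by simp
    also have "\<dots> = (16 * L * \<Delta> * \<sigma> + 2 * \<sigma>\<^sup>2 * \<epsilon> + 4 * \<sigma> * \<epsilon>\<^sup>2) / \<epsilon> ^ 3"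
      using p(1) by (simp add: field_simps power2_eq_square power3_eq_cube)
    also have "\<dots> \<le> ?c / \<epsilon> ^ 3"
      using p(1,3,4) assms(2,3) by (intro divide_right_mono add_mono mult_left_mono power_mono) auto
    finally show ?thesis
      using p(1) by simp
  qed
  then show "\<forall>\<^sub>F \<epsilon> in at 0 within E. norm (real (gradient_cost (S1 \<epsilon>) (S2 \<epsilon>) (q \<epsilon>) (K \<epsilon>))) \<le> ?c * norm (1 / \<epsilon> ^ 3)"
    by (simp add: eventually_at_filter)
qed

section \<open>Convergence and cost of SPIDER\<close>

text \<open>
The deterministic bound is integrated as an inequality between nonnegative functions. In this way
finiteness of the expected gradient norm, hence integrability, comes out of the bound itself.
\<close>

lemma (in stochastic_oracle) spider_expected_gradient_norm:
  fixes \<Omega> :: "'w measure"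
  assumes diff: "\<And>x. f differentiable (at x)" and bdd: "bdd_below (range f)" and "0 < L"
    and params: "spider_params L \<sigma> (f x0 - (INF x. f x)) \<epsilon> n0 S1 S2 q K"
    and rand: "spider_randomness \<Omega> M (sample_slots S1 S2 q K) K \<xi> \<kappa>"
  defines "x_out \<equiv> \<lambda>\<omega>. spider_iterate F S1 S2 q (step_size \<epsilon> L n0) x0 (\<lambda>p. \<xi> p \<omega>) (\<kappa> \<omega>)"
  shows "integrable \<Omega> (\<lambda>\<omega>. norm (grad f (x_out \<omega>)))"
    and "(\<integral>\<omega>. norm (grad f (x_out \<omega>)) \<partial>\<Omega>) \<le> 5 * \<epsilon>"
proof -
  let ?\<Delta> = "f x0 - (INF x. f x)"
  have "0 \<le> ?\<Delta>"
    using cINF_lower[OF bdd, of x0] by simp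
  note p = spider_params_facts[OF params \<open>0 < L\<close> this]
  have S1: "real S1 = 2 * \<sigma>\<^sup>2 / \<epsilon>\<^sup>2" and S2: "real S2 = 2 * \<sigma> / (\<epsilon> * n0)" and q: "real q = \<sigma> * n0 / \<epsilon>"
    using params by (auto simp: spider_params_def)
  interpret spider_process M F f L \<sigma> S1 S2 q K "step_size \<epsilon> L n0" x0 "\<epsilon> / (L * n0)"
  proof
    show "step_size \<epsilon> L n0 \<in> borel_measurable borel"
      unfolding step_size_def[abs_def] by measurable
    show "norm (step_size \<epsilon> L n0 v *\<^sub>R v) \<le> \<epsilon> / (L * n0)" for v :: 'a
      using p \<open>0 < L\<close> by (intro norm_step_le) auto
  qed (use p in auto)
  \<comment> \<open>The refresh and the corrections after it contribute at most half of the bound each.\<close>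
  have err: "(\<integral>\<^sup>+s. ennreal ((norm (err s k))\<^sup>2) \<partial>samples) \<le> ennreal (\<epsilon>\<^sup>2)" if "k < K" for k
  proof -
    have "real (k mod q) \<le> real q"
      using p(7) by (simp add: less_imp_le)
    then have "\<sigma>\<^sup>2 / real S1 + real (k mod q) * ((L * (\<epsilon> / (L * n0)))\<^sup>2 / real S2)
      \<le> \<sigma>\<^sup>2 / real S1 + real q * ((L * (\<epsilon> / (L * n0)))\<^sup>2 / real S2)"
      by (intro add_left_mono mult_right_mono) auto
    also have "\<dots> = \<epsilon>\<^sup>2"
      unfolding S1 S2 q using p(1-3) \<open>0 < L\<close> by (simp add: field_simps power2_eq_square)
    finally show ?thesis
      using nn_integral_err_le[OF that] by (meson ennreal_leI order_trans)
  qed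
  define c0 where "c0 = (4 * L * n0 * ?\<Delta> + real K * \<epsilon>\<^sup>2) / (real K * \<epsilon>)"
  define c1 where "c1 = 3 / (2 * real K * \<epsilon>)"
  have c: "0 \<le> c0" "0 \<le> c1"
    unfolding c0_def c1_def using p(1,2) \<open>0 < L\<close> \<open>0 \<le> ?\<Delta>\<close> by auto
  have path: "(\<Sum>k<K. ennreal (1 / real K) * ennreal (norm (grad f (iterate s k))))
    \<le> ennreal c0 + (\<Sum>k<K. ennreal c1 * ennreal ((norm (err s k))\<^sup>2))" for s
  proof -
    have "\<epsilon> * (\<Sum>k<K. norm (grad f (iterate s k)))
      \<le> 4 * L * n0 * ?\<Delta> + real K * \<epsilon>\<^sup>2 + 3 / 2 * (\<Sum>k<K. (norm (err s k))\<^sup>2)"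
      unfolding err_def using p(1,2) \<open>0 < L\<close>
      by (intro sum_norm_grad_spider_iterate_le[where ?S1.0 = S1 and ?S2.0 = S2 and q = q and F = F and s = s]
          diff grad_f_lipschitz bdd spider_eq) auto
    then have "1 / (real K * \<epsilon>) * (\<epsilon> * (\<Sum>k<K. norm (grad f (iterate s k))))
      \<le> 1 / (real K * \<epsilon>) * (4 * L * n0 * ?\<Delta> + real K * \<epsilon>\<^sup>2 + 3 / 2 * (\<Sum>k<K. (norm (err s k))\<^sup>2))"
      using p(1) by (intro mult_left_mono) auto
    also have "\<dots> = c0 + c1 * (\<Sum>k<K. (norm (err s k))\<^sup>2)"
      unfolding c0_def c1_def by (simp add: add_divide_distrib)
    finally have "(\<Sum>k<K. 1 / real K * norm (grad f (iterate s k))) \<le> c0 + (\<Sum>k<K. c1 * (norm (err s k))\<^sup>2)"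
      using p(1) by (simp add: sum_distrib_left)
    then have "ennreal (\<Sum>k<K. 1 / real K * norm (grad f (iterate s k)))
      \<le> ennreal (c0 + (\<Sum>k<K. c1 * (norm (err s k))\<^sup>2))"
      by (rule ennreal_leI)
    then show ?thesis
      using c by (simp add: ennreal_mult[symmetric] sum_nonneg)
  qed
  have [measurable]: "(\<lambda>s. err s k) \<in> borel_measurable samples" if "k \<in> {..<K}" for k
    using that err_measurable by simp
  let ?W = "\<lambda>k s. norm (grad f (iterate s k))"
  have meas: "?W k \<in> borel_measurable samples" if "k < K" for k
    using iterate_estimate_measurable[OF that]
    by (auto intro!: borel_measurable_norm measurable_compose[OF _ grad_f_measurable])
  have "(0, 0) \<in> slots"
    using S_pos p(8) by (simp add: slots_iff batch_size_def)
  then have "slots \<noteq> {}"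
    by blast
  let ?Y = "\<lambda>\<omega>. ?W (\<kappa> \<omega>) (\<lambda>p\<in>slots. \<xi> p \<omega>)"
  have Y_meas: "?Y \<in> borel_measurable \<Omega>"
    and Y_int: "(\<integral>\<^sup>+\<omega>. ennreal (?Y \<omega>) \<partial>\<Omega>)
      = (\<integral>\<^sup>+s. (\<Sum>k<K. ennreal (1 / real K) * ennreal (?W k s)) \<partial>samples)"
    by (rule spider_randomness_uniform_index[OF rand prob_space_axioms \<open>slots \<noteq> {}\<close> p(8), where W = ?W],
        erule meas)+
  have "(\<integral>\<^sup>+\<omega>. ennreal (?Y \<omega>) \<partial>\<Omega>)
    \<le> (\<integral>\<^sup>+s. ennreal c0 + (\<Sum>k<K. ennreal c1 * ennreal ((norm (err s k))\<^sup>2)) \<partial>samples)"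
    unfolding Y_int by (intro nn_integral_mono path)
  also have "\<dots> = ennreal c0 + (\<Sum>k<K. ennreal c1 * (\<integral>\<^sup>+s. ennreal ((norm (err s k))\<^sup>2) \<partial>samples))"
  proof -
    interpret samples: prob_space samples
      by (intro prob_space_PiM prob_space_axioms)
    show ?thesis
      by (subst nn_integral_add) (auto simp: nn_integral_sum nn_integral_cmult samples.emeasure_space_1)
  qed
  also have "\<dots> \<le> ennreal c0 + (\<Sum>k<K. ennreal c1 * ennreal (\<epsilon>\<^sup>2))"
    by (intro add_left_mono sum_mono mult_left_mono err) auto
  also have "\<dots> = ennreal (c0 + real K * (c1 * \<epsilon>\<^sup>2))"
    using c by (simp add: ennreal_mult ennreal_of_nat_eq_real_of_nat)
  also have "c0 + real K * (c1 * \<epsilon>\<^sup>2) \<le> 5 * \<epsilon>"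
  proof -
    have "c0 \<le> (real K * \<epsilon>\<^sup>2 + real K * \<epsilon>\<^sup>2) / (real K * \<epsilon>)"
      unfolding c0_def using p(1,10) by (intro divide_right_mono) (auto simp: mult_ac)
    also have "\<dots> = 2 * \<epsilon>"
      using p(1,8) by (simp add: power2_eq_square)
    finally have "c0 \<le> 2 * \<epsilon>" .
    moreover have "real K * (c1 * \<epsilon>\<^sup>2) = 3 / 2 * \<epsilon>"
      unfolding c1_def using p(1,8) by (simp add: power2_eq_square)
    ultimately show ?thesis
      using p(1) by linarith
  qed
  finally have bound: "(\<integral>\<^sup>+\<omega>. ennreal (?Y \<omega>) \<partial>\<Omega>) \<le> ennreal (5 * \<epsilon>)"
    by (simp add: ennreal_leI)
  have Y: "integrable \<Omega> ?Y"
    using Y_meas bound by (intro integrableI_nonneg) (auto simp: top.not_eq_extremum intro: le_less_trans)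
  \<comment> \<open>Outside the slots \<xi> is unconstrained, but the iterates before iteration K do not read it there.\<close>
  have out: "norm (grad f (x_out \<omega>)) = ?Y \<omega>" if "\<omega> \<in> space \<Omega>" for \<omega>
  proof -
    have "\<kappa> \<omega> < K"
      using rand measurable_space[of \<kappa> \<Omega> "count_space {..<K}"] that by (auto simp: spider_randomness_def)
    then have "iterate (\<lambda>p. \<xi> p \<omega>) (\<kappa> \<omega>) = iterate (\<lambda>p\<in>slots. \<xi> p \<omega>) (\<kappa> \<omega>)"
      by (intro iterate_estimate_cong) (simp add: slots_iff)
    then show ?thesis
      by (simp add: x_out_def iterate_def)
  qed
  show "integrable \<Omega> (\<lambda>\<omega>. norm (grad f (x_out \<omega>)))"
    using Y by (simp add: out cong: Bochner_Integration.integrable_cong)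
  have "(\<integral>\<omega>. ?Y \<omega> \<partial>\<Omega>) \<le> 5 * \<epsilon>"
    using Y_meas bound p(1) by (subst integral_eq_nn_integral) (auto intro: enn2real_leI)
  then show "(\<integral>\<omega>. norm (grad f (x_out \<omega>)) \<partial>\<Omega>) \<le> 5 * \<epsilon>"
    by (simp add: out cong: Bochner_Integration.integral_cong)
qed

theorem theorem1:
  fixes M :: "'i measure"
    and F :: "'i \<Rightarrow> 'a::euclidean_space \<Rightarrow> real"
    and f :: "'a \<Rightarrow> real"
    and x0 :: 'a
    and L \<sigma> \<Delta> :: real
  assumes "prob_space M"
    and "\<And>i x. i \<in> space M \<Longrightarrow> F i differentiable (at x)"
    and "\<And>x. integrable M (\<lambda>i. F i x)"
    and "\<And>x. f x = (\<integral>i. F i x \<partial>M)"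
    and "\<And>x. f differentiable (at x)"
    and "\<And>x. integrable M (\<lambda>i. grad (F i) x)"
    and "\<And>x. (\<integral>i. grad (F i) x \<partial>M) = grad f x"
    and "bdd_below (range f)"
    and "\<Delta> = f x0 - (INF x. f x)"
    and "L > 0"
    and "\<And>x y. integrable M (\<lambda>i. (norm (grad (F i) x - grad (F i) y))\<^sup>2)"
    and "\<And>x y. (\<integral>i. (norm (grad (F i) x - grad (F i) y))\<^sup>2 \<partial>M) \<le> L\<^sup>2 * (norm (x - y))\<^sup>2"
    and "\<And>x. integrable M (\<lambda>i. (norm (grad (F i) x - grad f x))\<^sup>2)"
    and "\<And>x. (\<integral>i. (norm (grad (F i) x - grad f x))\<^sup>2 \<partial>M) \<le> \<sigma>\<^sup>2"
  shows
    "(\<forall>\<epsilon> n0 S1 S2 q K (\<Omega> :: 'w measure) \<xi> \<kappa>.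
        spider_params L \<sigma> \<Delta> \<epsilon> n0 S1 S2 q K \<and>
        spider_randomness \<Omega> M (sample_slots S1 S2 q K) K \<xi> \<kappa> \<longrightarrow>
          (let x_out = (\<lambda>\<omega>. spider_iterate F S1 S2 q (step_size \<epsilon> L n0) x0
                                 (\<lambda>p. \<xi> p \<omega>) (\<kappa> \<omega>))
           in integrable \<Omega> (\<lambda>\<omega>. norm (grad f (x_out \<omega>))) \<and>
              (\<integral>\<omega>. norm (grad f (x_out \<omega>)) \<partial>\<Omega>) \<le> 5 * \<epsilon>) \<and>
          real (gradient_cost S1 S2 q K)
            \<le> 16 * L * \<Delta> * \<sigma> / \<epsilon> ^ 3 + 2 * \<sigma>\<^sup>2 / \<epsilon>\<^sup>2 + 4 * \<sigma> / (n0 * \<epsilon>)) \<and>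
     (\<forall>E n0 S1 S2 q K.
        (\<forall>\<epsilon>\<in>E. spider_params L \<sigma> \<Delta> \<epsilon> (n0 \<epsilon>) (S1 \<epsilon>) (S2 \<epsilon>) (q \<epsilon>) (K \<epsilon>)) \<longrightarrow>
          (\<lambda>\<epsilon>. real (gradient_cost (S1 \<epsilon>) (S2 \<epsilon>) (q \<epsilon>) (K \<epsilon>)))
            \<in> O[at 0 within E](\<lambda>\<epsilon>. 1 / \<epsilon> ^ 3))"
proof -
  interpret orc: stochastic_oracle M F f L \<sigma>
    using assms by (intro stochastic_oracle.intro stochastic_oracle_axioms.intro) auto
  have \<Delta>: "0 \<le> \<Delta>"
    using cINF_lower[OF assms(8), of x0] assms(9) by simp
  show ?thesis
    unfolding Let_def
  proof (rule conjI; intro allI impI)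
    fix \<epsilon> n0 S1 S2 q K and \<Omega> :: "'w measure" and \<xi> \<kappa>
    assume "spider_params L \<sigma> \<Delta> \<epsilon> n0 S1 S2 q K \<and>
      spider_randomness \<Omega> M (sample_slots S1 S2 q K) K \<xi> \<kappa>"
    then have params: "spider_params L \<sigma> \<Delta> \<epsilon> n0 S1 S2 q K"
      and rand: "spider_randomness \<Omega> M (sample_slots S1 S2 q K) K \<xi> \<kappa>"
      by auto
    note out = orc.spider_expected_gradient_norm[OF assms(5,8,10) params[unfolded assms(9)] rand]
    show "(integrable \<Omega> (\<lambda>\<omega>. norm (grad f (spider_iterate F S1 S2 q (step_size \<epsilon> L n0) x0 (\<lambda>p. \<xi> p \<omega>) (\<kappa> \<omega>)))) \<and>
        (\<integral>\<omega>. norm (grad f (spider_iterate F S1 S2 q (step_size \<epsilon> L n0) x0 (\<lambda>p. \<xi> p \<omega>) (\<kappa> \<omega>))) \<partial>\<Omega>) \<le> 5 * \<epsilon>) \<and>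
      real (gradient_cost S1 S2 q K)
        \<le> 16 * L * \<Delta> * \<sigma> / \<epsilon> ^ 3 + 2 * \<sigma>\<^sup>2 / \<epsilon>\<^sup>2 + 4 * \<sigma> / (n0 * \<epsilon>)"
      using out spider_gradient_cost_le[OF params assms(10) \<Delta>] by blast
  next
    fix E :: "real set" and n0 S1 S2 q K
    assume "\<forall>\<epsilon>\<in>E. spider_params L \<sigma> \<Delta> \<epsilon> (n0 \<epsilon>) (S1 \<epsilon>) (S2 \<epsilon>) (q \<epsilon>) (K \<epsilon>)"
    then show "(\<lambda>\<epsilon>. real (gradient_cost (S1 \<epsilon>) (S2 \<epsilon>) (q \<epsilon>) (K \<epsilon>))) \<in> O[at 0 within E](\<lambda>\<epsilon>. 1 / \<epsilon> ^ 3)"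
      by (intro spider_gradient_cost_bigo[OF _ assms(10) \<Delta>, where ?n0.0 = n0]) auto
  qed
qed

end
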